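(* Let $P$ be a point that does not lie on the extended sides of triangle $ABC$ or of its anticomplementary triangle. Let $G_1=T_P(G)$ and $G_2=T_{P'}(G)$ be the centroids of the cevian triangles $DEF$ and $D_3E_3F_3$ of $P$ and $P'$. Then the centroid $G$ of $ABC$ is the midpoint of the segment $G_1G_2$, and (if $P\neq G$) the line $G_1G_2$ is parallel to the line $PP'$. In other words, $\eta(G_1)=G_2$ when $P$ and $P'$ are ordinary and $P$ does not lie on a median of $ABC$.
   Context: Work in the extended Euclidean plane: the Euclidean plane together with the line at infinity $l_\infty$. Points on $l_\infty$ are called infinite, all other points ordinary; affine maps are extended to $l_\infty$. $XY$ denotes the line through $X$ and $Y$, and $l\cdot m$ the intersection point of lines $l$ and $m$. Parallel lines are allowed to coincide. $ABC$ is a (nondegenerate) triangle with centroid $G$; medians are the full lines $AG,BG,CG$. $K$ is the homothety with center $G$ and ratio $-1/2$; the anticomplementary triangle is $K^{-1}(ABC)$. $P$ may be ordinary or infinite. $D=AP\cdot BC$, $E=BP\cdot CA$, $F=CP\cdot AB$ are the traces of $P$, and $D_3,E_3,F_3$ are their reflections in the midpoints of $BC,CA,AB$ respectively; the lines $AD_3,BE_3,CF_3$ meet in the isotomic conjugate $P'$ of $P$. Put $Q=K(P')$, $Q'=K(P)$. $T_P$ is the unique affine map with $A\mapsto D$, $B\mapsto E$, $C\mapsto F$; $T_{P'}$ is the unique affine map with $A\mapsto D_3$, $B\mapsto E_3$, $C\mapsto F_3$. When $P$ and $P'$ are ordinary and $P$ is not on a median, $V=PQ\cdot P'Q'$, $V_\infty=PP'\cdot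 QQ'$ (an infinite point), and $\eta$ is the harmonic homology with center $V_\infty$ and axis $GV$: the affine reflection that fixes $GV$ pointwise and maps each ordinary point $Y\notin GV$ to the point $Y'$ such that $YY'\parallel PP'$ and the midpoint of $YY'$ lies on $GV$. *)

theory Defs
  imports "HOL-Analysis.Analysis"
begin

section \<open>The extended Euclidean plane\<close>

text \<open>A point at infinity is a direction, i.e. a one-dimensional subspace of the plane.\<close>

typedef direction = "{L :: (real^2) set. subspace L \<and> dim L = 1}"
proof -
  have "dim (span {axis 1 1 :: real^2}) = 1"
    by (simp add: dim_eq_card_independent axis_eq_0_iff)
  then show ?thesis
    using subspace_span by blast
qed

datatype xpoint = Ordinary "real^2" | Infinite direction

definition ordinary :: "xpoint \<Rightarrow> bool" where
  "ordinary X \<longleftrightarrow> X \<in> range Ordinary"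

definition line_infty :: "xpoint set" where
  "line_infty = range Infinite"

definition direction_of :: "(real^2) set \<Rightarrow> direction" where
  "direction_of l = Abs_direction {y - x | x y. x \<in> l \<and> y \<in> l}"

definition ext_line :: "(real^2) set \<Rightarrow> xpoint set" where
  "ext_line l = insert (Infinite (direction_of l)) (Ordinary ` l)"

definition ordinary_lines :: "xpoint set set" where
  "ordinary_lines = ext_line ` {l. affine l \<and> aff_dim l = 1}"

definition xlines :: "xpoint set set" where
  "xlines = insert line_infty ordinary_lines"

text \<open>The line \<open>XY\<close> (for \<open>X \<noteq> Y\<close>) and the point \<open>l \<cdot> m\<close> (for \<open>l \<noteq> m\<close>).\<close>

definition join :: "xpoint \<Rightarrow> xpoint \<Rightarrow> xpoint set" where
  "join X Y = (THE l. l \<in> xlines \<and> X \<in> l \<and> Y \<in> l)"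

definition meet :: "xpoint set \<Rightarrow> xpoint set \<Rightarrow> xpoint" where
  "meet l m = (THE X. X \<in> l \<and> X \<in> m)"

text \<open>Parallel lines may coincide.\<close>

definition parallel :: "xpoint set \<Rightarrow> xpoint set \<Rightarrow> bool" where
  "parallel l m \<longleftrightarrow>
     l \<in> ordinary_lines \<and> m \<in> ordinary_lines \<and> l \<inter> line_infty = m \<inter> line_infty"


section \<open>Affine maps\<close>

definition affine_map :: "(real^2 \<Rightarrow> real^2) \<Rightarrow> bool" where
  "affine_map T \<longleftrightarrow> (\<exists>L c. linear L \<and> T = (\<lambda>x. L x + c))"

text \<open>Extension of an injective affine map to the line at infinity, through its linear part.\<close>

primrec ext_map :: "(real^2 \<Rightarrow> real^2) \<Rightarrow> xpoint \<Rightarrow> xpoint" where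
  "ext_map f (Ordinary x) = Ordinary (f x)"
| "ext_map f (Infinite d) = Infinite (Abs_direction ((\<lambda>v. f v - f 0) ` Rep_direction d))"

definition homothety :: "real^2 \<Rightarrow> real \<Rightarrow> real^2 \<Rightarrow> real^2" where
  "homothety Z r X = Z + r *\<^sub>R (X - Z)"

text \<open>The affine map with \<open>A \<mapsto> D\<close>, \<open>B \<mapsto> E\<close>, \<open>C \<mapsto> F\<close>
  (unique if \<open>ABC\<close> is a nondegenerate triangle and \<open>D\<close>, \<open>E\<close>, \<open>F\<close> are ordinary).\<close>

definition triangle_map ::
  "real^2 \<Rightarrow> real^2 \<Rightarrow> real^2 \<Rightarrow> xpoint \<Rightarrow> xpoint \<Rightarrow> xpoint \<Rightarrow> real^2 \<Rightarrow> real^2" where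
  "triangle_map A B C D E F =
     (THE T. affine_map T \<and> Ordinary (T A) = D \<and> Ordinary (T B) = E \<and> Ordinary (T C) = F)"


section \<open>Triangle geometry\<close>

definition centroid :: "real^2 \<Rightarrow> real^2 \<Rightarrow> real^2 \<Rightarrow> real^2" where
  "centroid A B C = (1/3) *\<^sub>R (A + B + C)"

lemma affine_map_centroid:
  assumes "affine_map T"
  shows "T (centroid A B C) = centroid (T A) (T B) (T C)"
proof -
  obtain L c where "linear L" and T: "T = (\<lambda>x. L x + c)"
    using assms by (auto simp: affine_map_def)
  have "c = (1/3) *\<^sub>R (c + c + c)"
    by (simp add: scaleR_add_right flip: scaleR_left_distrib)
  moreover have "L ((1/3) *\<^sub>R (A + B + C)) = (1/3) *\<^sub>R (L A + L B + L C)"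
    using \<open>linear L\<close> by (simp add: linear_add linear_scale)
  ultimately have "L ((1/3) *\<^sub>R (A + B + C)) + c = (1/3) *\<^sub>R (L A + L B + L C) + (1/3) *\<^sub>R (c + c + c)"
    by simp
  also have "\<dots> = (1/3) *\<^sub>R ((L A + c) + (L B + c) + (L C + c))"
    unfolding scaleR_add_right by (simp add: ac_simps)
  finally show ?thesis
    by (simp add: centroid_def T)
qed

definition complement_map :: "real^2 \<Rightarrow> real^2 \<Rightarrow> real^2 \<Rightarrow> real^2 \<Rightarrow> real^2" where
  "complement_map A B C = homothety (centroid A B C) (-1/2)"

text \<open>The union of the three extended side lines.\<close>

definition on_sides :: "real^2 \<Rightarrow> real^2 \<Rightarrow> real^2 \<Rightarrow> xpoint \<Rightarrow> bool" where
  "on_sides A B C X \<longleftrightarrow>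
     X \<in> join (Ordinary B) (Ordinary C) \<or>
     X \<in> join (Ordinary C) (Ordinary A) \<or>
     X \<in> join (Ordinary A) (Ordinary B)"

definition on_medians :: "real^2 \<Rightarrow> real^2 \<Rightarrow> real^2 \<Rightarrow> xpoint \<Rightarrow> bool" where
  "on_medians A B C X \<longleftrightarrow>
     (let G = Ordinary (centroid A B C) in
      X \<in> join (Ordinary A) G \<or> X \<in> join (Ordinary B) G \<or> X \<in> join (Ordinary C) G)"

text \<open>The trace on \<open>BC\<close> of the cevian through \<open>A\<close>, and its reflection in the midpoint of \<open>BC\<close>;
  the traces on \<open>CA\<close> and \<open>AB\<close> are obtained by permuting \<open>A\<close>, \<open>B\<close>, \<open>C\<close> cyclically.\<close>

definition cevian_trace :: "real^2 \<Rightarrow> real^2 \<Rightarrow> real^2 \<Rightarrow> xpoint \<Rightarrow> xpoint" where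
  "cevian_trace A B C P = meet (join (Ordinary A) P) (join (Ordinary B) (Ordinary C))"

definition refl_trace :: "real^2 \<Rightarrow> real^2 \<Rightarrow> real^2 \<Rightarrow> xpoint \<Rightarrow> xpoint" where
  "refl_trace A B C P = ext_map (homothety (midpoint B C) (-1)) (cevian_trace A B C P)"

definition isotomic_conjugate :: "real^2 \<Rightarrow> real^2 \<Rightarrow> real^2 \<Rightarrow> xpoint \<Rightarrow> xpoint" where
  "isotomic_conjugate A B C P =
     (THE X. X \<in> join (Ordinary A) (refl_trace A B C P) \<and>
             X \<in> join (Ordinary B) (refl_trace B C A P) \<and>
             X \<in> join (Ordinary C) (refl_trace C A B P))"

text \<open>\<open>T_P\<close> and \<open>T_P'\<close>, the latter via the reflected traces of \<open>P\<close>.\<close>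

definition cevian_map :: "real^2 \<Rightarrow> real^2 \<Rightarrow> real^2 \<Rightarrow> xpoint \<Rightarrow> real^2 \<Rightarrow> real^2" where
  "cevian_map A B C P =
     triangle_map A B C (cevian_trace A B C P) (cevian_trace B C A P) (cevian_trace C A B P)"

definition isotomic_cevian_map :: "real^2 \<Rightarrow> real^2 \<Rightarrow> real^2 \<Rightarrow> xpoint \<Rightarrow> real^2 \<Rightarrow> real^2" where
  "isotomic_cevian_map A B C P =
     triangle_map A B C (refl_trace A B C P) (refl_trace B C A P) (refl_trace C A B P)"


section \<open>The affine reflection\<close>

text \<open>The harmonic homology with infinite center \<open>Z\<close> and axis \<open>a\<close>, on ordinary points: the harmonic
  conjugate of the infinite point of the line \<open>YY'\<close> with respect to \<open>Y\<close>, \<open>Y'\<close> is their midpoint.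
  By \<open>parallel_iff_infinite_point\<close>, \<open>Z \<in> YY'\<close> says that \<open>YY'\<close> is parallel to any given
  ordinary line through \<open>Z\<close>.\<close>

definition harmonic_homology :: "xpoint \<Rightarrow> xpoint set \<Rightarrow> real^2 \<Rightarrow> real^2" where
  "harmonic_homology Z a Y =
     (if Ordinary Y \<in> a then Y
      else (THE Y'. Z \<in> join (Ordinary Y) (Ordinary Y') \<and> Ordinary (midpoint Y Y') \<in> a))"

lemma parallel_iff_infinite_point:
  assumes "l \<in> ordinary_lines" "m \<in> ordinary_lines" "Z \<in> m" "\<not> ordinary Z"
  shows "parallel l m \<longleftrightarrow> Z \<in> l"
  using assms
  by (cases Z) (auto simp: parallel_def ordinary_lines_def ext_line_def line_infty_def ordinary_def)

definition eta :: "real^2 \<Rightarrow> real^2 \<Rightarrow> real^2 \<Rightarrow> xpoint \<Rightarrow> real^2 \<Rightarrow> real^2" where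
  "eta A B C P =
     (let G = Ordinary (centroid A B C);
          K = ext_map (complement_map A B C);
          P' = isotomic_conjugate A B C P;
          Q = K P';
          Q' = K P;
          V = meet (join P Q) (join P' Q');
          V_infty = meet (join P P') (join Q Q')
      in harmonic_homology V_infty (join G V))"

end

theory Submission
  imports Defs
begin

text \<open>Write \<open>P = (x : y : z)\<close> in homogeneous barycentric coordinates with respect to \<open>ABC\<close>, ordinary
points having \<open>x + y + z \<noteq> 0\<close> and infinite ones \<open>x + y + z = 0\<close>. In these coordinates the join of two
points and the meet of two lines are both given by the vector product (\<open>join_bary_points\<close>,
\<open>meet_bary_lines\<close>), whether or not a point or a line is at infinity. The hypotheses on \<open>P\<close> say that
\<open>x\<close>, \<open>y\<close>, \<open>z\<close> and \<open>y + z\<close>, \<open>z + x\<close>, \<open>x + y\<close> do not vanish, and one computes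
\<open>D = (0 : y : z)\<close>, \<open>D\<^sub>3 = (0 : z : y)\<close> and \<open>P' = (yz : zx : xy)\<close>.

For the midpoint, note that a trace and its reflection add up to the sum of two vertices, so
\<open>D + E + F + D\<^sub>3 + E\<^sub>3 + F\<^sub>3 = 2 (A + B + C)\<close>, that is, \<open>G1 + G2 = 2 G\<close>.

For the parallelism, put \<open>s = x + y + z\<close> and \<open>s' = xy + yz + zx\<close>. The combination
\<open>d = s' (x, y, z) - s (yz, zx, xy)\<close> has coordinate sum \<open>0\<close>, so it is the infinite point of \<open>PP'\<close>.
Its first coordinate is \<open>(x\<^sup>2 - yz)(y + z)\<close>, and
\<open>x/(z + x) + x/(x + y) - 1 = (x\<^sup>2 - yz) / ((x + y)(z + x))\<close> shows that \<open>3 (G1 - G)\<close> is \<open>d\<close> divided by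
\<open>(x + y)(y + z)(z + x)\<close> (\<open>centroid_of_cevian_triangle\<close>). Moreover \<open>d = 0\<close> happens only for
\<open>P = G\<close>.

It remains to identify \<open>\<eta>\<close>. Off the medians, \<open>G\<close>, \<open>P\<close>, \<open>P'\<close> form a triangle, and they determine everything that
occurs in \<open>\<eta>\<close>. With \<open>G\<close> as origin, \<open>Q = -P'/2\<close> and \<open>Q' = -P/2\<close>, hence \<open>V = -(P + P')\<close>; the axis \<open>GV\<close> is
a median of that triangle and the center is the infinite point of \<open>PP'\<close>. So \<open>\<eta>\<close> exchanges
\<open>G + t (P - P')\<close> and \<open>G - t (P - P')\<close> (\<open>harmonic_homology_on_parallel\<close>), and these are \<open>G1\<close> and \<open>G2\<close>
for a suitable \<open>t\<close> by the two preceding parts.\<close>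

unbundle cross3_syntax

section \<open>Homogeneous Cartesian coordinates on the extended plane\<close>

text \<open>The pair \<open>(v, s)\<close> plays the role of the usual coordinate triple \<open>(v\<^sub>1 : v\<^sub>2 : s)\<close>.\<close>

definition hom_point :: "real^2 \<Rightarrow> real \<Rightarrow> xpoint" where
  "hom_point v s =
     (if s = 0 then Infinite (Abs_direction (span {v})) else Ordinary (v /\<^sub>R s))"

definition hom_line :: "real^2 \<Rightarrow> real \<Rightarrow> xpoint set" where
  "hom_line a b = {hom_point v s | v s. (v, s) \<noteq> (0, 0) \<and> a \<bullet> v = b * s}"

lemma span_singleton_is_direction:
  fixes v :: "real^2"
  assumes "v \<noteq> 0"
  shows "span {v} \<in> {L. subspace L \<and> dim L = 1}"
  using assms by (simp add: dim_eq_card_independent subspace_span)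

lemma hom_point_eqD:
  assumes "(v, s) \<noteq> (0, 0)" "(w, t) \<noteq> (0, 0)" "hom_point v s = hom_point w t"
  obtains c where "c \<noteq> 0" "w = c *\<^sub>R v" "t = c * s"
proof (cases "s = 0")
  case True
  then have t: "t = 0" and v: "v \<noteq> 0" and w: "w \<noteq> 0"
    using assms by (auto simp: hom_point_def split: if_splits)
  have "Abs_direction (span {v}) = Abs_direction (span {w})"
    using assms(3) True t by (simp add: hom_point_def)
  then have "span {v} = span {w}"
    by (simp only: Abs_direction_inject[OF span_singleton_is_direction[OF v]
          span_singleton_is_direction[OF w]])
  then have "w \<in> span {v}"
    by (simp add: span_base)
  then obtain c where "w = c *\<^sub>R v"
    by (auto simp: span_singleton)
  then show ?thesis
    using that[of c] w True t by auto
next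
  case False
  then have t: "t \<noteq> 0"
    using assms by (auto simp: hom_point_def split: if_splits)
  have "v /\<^sub>R s = w /\<^sub>R t"
    using assms(3) False t by (simp add: hom_point_def)
  then have "t *\<^sub>R (v /\<^sub>R s) = t *\<^sub>R (w /\<^sub>R t)"
    by simp
  then have "w = (t / s) *\<^sub>R v"
    using t by (simp add: divide_inverse)
  then show ?thesis
    using that[of "t / s"] False t by simp
qed

lemma hom_point_scale:
  assumes "c \<noteq> 0"
  shows "hom_point (c *\<^sub>R v) (c * s) = hom_point v s"
proof (cases "s = 0")
  case True
  have "span {c *\<^sub>R v} = span {v}"
    using span_image_scale[of "{v}" "\<lambda>_. c"] assms by simp
  then show ?thesis
    by (simp add: hom_point_def True)
qed (use assms in \<open>simp add: hom_point_def\<close>)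

lemma infinite_eq_hom_point:
  obtains v where "v \<noteq> 0" "Infinite d = hom_point v 0"
proof -
  have "subspace (Rep_direction d)" "dim (Rep_direction d) = 1"
    using Rep_direction[of d] by auto
  then obtain v where v: "v \<noteq> 0" "Rep_direction d = span {v}"
  proof -
    obtain Bs where "Bs \<subseteq> Rep_direction d" "independent Bs" "Rep_direction d \<subseteq> span Bs"
        "card Bs = dim (Rep_direction d)"
      using basis_exists[of "Rep_direction d"] by metis
    then obtain v where "Bs = {v}"
      using \<open>dim (Rep_direction d) = 1\<close> by (auto simp: card_1_singleton_iff)
    then show ?thesis
      using that[of v] \<open>Rep_direction d \<subseteq> span Bs\<close> \<open>Bs \<subseteq> Rep_direction d\<close>
        \<open>independent Bs\<close> \<open>subspace (Rep_direction d)\<close>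
      by (metis dependent_single span_minimal subset_antisym)
  qed
  then have "d = Abs_direction (span {v})"
    by (metis Rep_direction_inverse)
  then show ?thesis
    using that[of v] v by (simp add: hom_point_def)
qed

lemma hom_point_cases:
  obtains v s where "(v, s) \<noteq> (0, 0)" "X = hom_point v s"
proof (cases X)
  case (Ordinary x)
  then show ?thesis
    using that[of x 1] by (simp add: hom_point_def)
next
  case (Infinite d)
  obtain v where "v \<noteq> 0" "Infinite d = hom_point v 0"
    by (rule infinite_eq_hom_point)
  then show ?thesis
    using that[of v 0] Infinite by simp
qed

lemma hom_line_0:
  assumes "b \<noteq> 0"
  shows "hom_line 0 b = line_infty"
proof
  show "hom_line 0 b \<subseteq> line_infty"
    using assms by (auto simp: hom_line_def line_infty_def hom_point_def)
  show "line_infty \<subseteq> hom_line 0 b"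
  proof
    fix X assume "X \<in> line_infty"
    then obtain v where "v \<noteq> 0" "X = hom_point v 0"
      by (auto simp: line_infty_def elim: infinite_eq_hom_point)
    then show "X \<in> hom_line 0 b"
      by (force simp: hom_line_def)
  qed
qed

text \<open>The direction of the line is the kernel of \<open>v \<mapsto> a \<bullet> v\<close>, which is one-dimensional in the plane and so
is spanned by any nonzero vector that it contains.\<close>

lemma ext_line_hyperplane:
  assumes "a \<noteq> 0"
  shows "ext_line {x. a \<bullet> x = b} = hom_line a b"
proof -
  let ?l = "{x. a \<bullet> x = b}"
  have diffs: "{y - x |x y. x \<in> ?l \<and> y \<in> ?l} = {v. a \<bullet> v = 0}"
  proof safe
    fix v assume "a \<bullet> v = 0"
    moreover obtain x where "a \<bullet> x = b"
    proof -
      have "a \<bullet> ((b / (a \<bullet> a)) *\<^sub>R a) = b"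
        using assms by simp
      then show ?thesis using that by blast
    qed
    ultimately have "v = (v + x) - x \<and> x \<in> ?l \<and> v + x \<in> ?l"
      by (simp add: inner_add_right)
    then show "\<exists>x y. v = y - x \<and> x \<in> ?l \<and> y \<in> ?l"
      by blast
  qed (simp add: inner_diff_right)
  have span: "span {v} = {v. a \<bullet> v = 0}" if "a \<bullet> v = 0" "v \<noteq> 0" for v
  proof (rule subspace_dim_equal)
    show "span {v} \<subseteq> {v. a \<bullet> v = 0}"
      using that by (auto simp: span_singleton)
    show "dim {v. a \<bullet> v = 0} \<le> dim (span {v})"
      using assms span_singleton_is_direction[OF \<open>v \<noteq> 0\<close>] by (simp add: dim_hyperplane)
  qed (auto simp: subspace_hyperplane)
  have dir: "direction_of ?l = Abs_direction {v. a \<bullet> v = 0}"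
    unfolding direction_of_def diffs ..
  show ?thesis
  proof
    show "hom_line a b \<subseteq> ext_line ?l"
      using dir span by (auto simp: hom_line_def ext_line_def hom_point_def field_simps)
    have "Infinite (direction_of ?l) \<in> hom_line a b"
    proof -
      have "dim {v. a \<bullet> v = 0} = 1"
        using assms by (simp add: dim_hyperplane)
      then have "\<not> {v. a \<bullet> v = 0} \<subseteq> {0}"
        by (metis dim_eq_0 zero_neq_one)
      then obtain v where "a \<bullet> v = 0" "v \<noteq> 0"
        by blast
      then have "Infinite (direction_of ?l) = hom_point v 0"
        by (simp add: hom_point_def dir span)
      then show ?thesis
        unfolding hom_line_def using \<open>a \<bullet> v = 0\<close> \<open>v \<noteq> 0\<close> by fastforce
    qed
    moreover have "Ordinary x \<in> hom_line a b" if "a \<bullet> x = b" for x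
    proof -
      have "Ordinary x = hom_point x 1"
        by (simp add: hom_point_def)
      then show ?thesis
        unfolding hom_line_def using that by fastforce
    qed
    ultimately show "ext_line ?l \<subseteq> hom_line a b"
      by (auto simp: ext_line_def)
  qed
qed

lemma affine_line_iff_hyperplane:
  fixes l :: "(real^2) set"
  shows "affine l \<and> aff_dim l = 1 \<longleftrightarrow> (\<exists>a b. a \<noteq> 0 \<and> l = {x. a \<bullet> x = b})"
proof
  assume l: "affine l \<and> aff_dim l = 1"
  then have "\<exists>a b. a \<noteq> 0 \<and> affine hull l = {x. a \<bullet> x = b}"
    using aff_dim_eq_hyperplane[of l] by simp
  moreover have "affine hull l = l"
    using l by (simp add: affine_hull_eq)
  ultimately show "\<exists>a b. a \<noteq> 0 \<and> l = {x. a \<bullet> x = b}"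
    by simp
next
  assume "\<exists>a b. a \<noteq> 0 \<and> l = {x. a \<bullet> x = b}"
  then show "affine l \<and> aff_dim l = 1"
    by (auto simp: affine_hyperplane)
qed

lemma ordinary_lines_eq: "ordinary_lines = {hom_line a b | a b. a \<noteq> 0}"
proof safe
  fix l assume "l \<in> ordinary_lines"
  then obtain l' where l': "l = ext_line l'" "affine l' \<and> aff_dim l' = 1"
    by (auto simp: ordinary_lines_def)
  then obtain a b where "a \<noteq> 0" "l' = {x. a \<bullet> x = b}"
    unfolding affine_line_iff_hyperplane by blast
  then show "\<exists>a b. l = hom_line a b \<and> a \<noteq> 0"
    using l'(1) ext_line_hyperplane by blast
next
  fix a :: "real^2" and b :: real assume a: "a \<noteq> 0"
  then have "affine {x. a \<bullet> x = b} \<and> aff_dim {x. a \<bullet> x = b} = 1"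
    unfolding affine_line_iff_hyperplane by blast
  then show "hom_line a b \<in> ordinary_lines"
    unfolding ordinary_lines_def ext_line_hyperplane[OF a, symmetric] by blast
qed

text \<open>The case \<open>a = 0\<close> is the line at infinity, so one linear equation describes every extended line.\<close>

lemma xlines_eq: "xlines = {hom_line a b | a b. (a, b) \<noteq> (0, 0)}"
proof -
  have "line_infty = hom_line 0 1"
    by (simp add: hom_line_0)
  then show ?thesis
    unfolding xlines_def ordinary_lines_eq using hom_line_0
    by (auto 4 0)
qed

section \<open>Homogeneous barycentric coordinates\<close>

definition bary_weight :: "real^3 \<Rightarrow> real" where
  "bary_weight p = p$1 + p$2 + p$3"

definition bary_vector :: "real^2 \<Rightarrow> real^2 \<Rightarrow> real^2 \<Rightarrow> real^3 \<Rightarrow> real^2" where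
  "bary_vector A B C p = p$1 *\<^sub>R A + p$2 *\<^sub>R B + p$3 *\<^sub>R C"

definition bary_point :: "real^2 \<Rightarrow> real^2 \<Rightarrow> real^2 \<Rightarrow> real^3 \<Rightarrow> xpoint" where
  "bary_point A B C p = hom_point (bary_vector A B C p) (bary_weight p)"

definition bary_line :: "real^2 \<Rightarrow> real^2 \<Rightarrow> real^2 \<Rightarrow> real^3 \<Rightarrow> xpoint set" where
  "bary_line A B C u = {bary_point A B C p | p. p \<noteq> 0 \<and> u \<bullet> p = 0}"

lemma linear_bary: "linear (\<lambda>p. (bary_vector A B C p, bary_weight p))"
  by (rule linearI) (simp_all add: bary_vector_def bary_weight_def algebra_simps)

lemma vec3_eq_iff: "u = v \<longleftrightarrow> u$1 = v$1 \<and> u$2 = v$2 \<and> u$3 = v$3" for u v :: "'a^3"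
  by (simp add: vec_eq_iff forall_3)

lemma inner_vec3: "u \<bullet> v = u$1 * v$1 + u$2 * v$2 + u$3 * v$3" for u v :: "real^3"
  by (simp add: inner_vec_def sum_3)

text \<open>The functional \<open>(a, b)\<close> is found by counting dimensions: assigning to it its values at \<open>A\<close>, \<open>B\<close>, \<open>C\<close>
is injective, since the zero line of a functional that vanishes at all three would contain the triangle.\<close>

lemma bary_functional_exists:
  assumes "\<not> collinear {A, B, C}"
  obtains a b where "\<And>p. u \<bullet> p = a \<bullet> bary_vector A B C p - b * bary_weight p"
proof -
  define f :: "(real^2) \<times> real \<Rightarrow> real^3"
    where "f = (\<lambda>(a, b). vector [a \<bullet> A - b, a \<bullet> B - b, a \<bullet> C - b])"
  have f: "linear f"
    by (rule linearI) (auto simp: f_def vec3_eq_iff algebra_simps)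
  have "(a, b) = 0" if "f (a, b) = 0" for a b
  proof -
    have eqs: "a \<bullet> A = b" "a \<bullet> B = b" "a \<bullet> C = b"
      using that by (auto simp: f_def vec3_eq_iff)
    have "a = 0"
    proof (rule ccontr)
      assume "a \<noteq> 0"
      then have "aff_dim {x. a \<bullet> x = b} = 1"
        by simp
      moreover have "{A, B, C} \<subseteq> {x. a \<bullet> x = b}"
        using eqs by simp
      ultimately have "collinear {A, B, C}"
        by (metis aff_dim_subset collinear_aff_dim)
      then show False using assms by simp
    qed
    then show ?thesis using eqs by (simp add: zero_prod_def)
  qed
  then have "inj f"
    using f by (auto simp: linear_injective_0)
  then have "surj f"
    using f by (intro linear_injective_imp_surjective) auto
  then obtain a b where "u = f (a, b)"
    by (metis surjD surj_pair)
  then have "u \<bullet> p = a \<bullet> bary_vector A B C p - b * bary_weight p" for p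
    by (simp add: f_def inner_vec3 bary_vector_def bary_weight_def algebra_simps)
  then show ?thesis by (rule that)
qed

text \<open>A coordinate vector with image \<open>0\<close> is orthogonal to itself, because its inner product with anything
factors through the map.\<close>

lemma bary_bij:
  assumes "\<not> collinear {A, B, C}"
  shows "bij (\<lambda>p. (bary_vector A B C p, bary_weight p))"
proof -
  let ?f = "\<lambda>p. (bary_vector A B C p, bary_weight p)"
  have "p = 0" if fp: "?f p = 0" for p
  proof -
    obtain a b where "\<And>q. p \<bullet> q = a \<bullet> bary_vector A B C q - b * bary_weight q"
      by (rule bary_functional_exists[OF assms, of p]) (rule that)
    from this[of p] have "p \<bullet> p = 0"
      using fp by (simp add: zero_prod_def)
    then show ?thesis by simp
  qed
  then have inj: "inj ?f"
    unfolding linear_injective_0[OF linear_bary] by blast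
  have "surj ?f"
    by (rule linear_injective_imp_surjective[OF linear_bary inj]) simp
  with inj show ?thesis by (simp add: bij_def)
qed

lemma bary_nonzero:
  assumes "\<not> collinear {A, B, C}" "p \<noteq> 0"
  shows "(bary_vector A B C p, bary_weight p) \<noteq> (0, 0)"
proof
  assume "(bary_vector A B C p, bary_weight p) = (0, 0)"
  then have "(bary_vector A B C p, bary_weight p) = (bary_vector A B C 0, bary_weight 0)"
    by (simp add: bary_vector_def bary_weight_def)
  from injD[OF bij_is_inj[OF bary_bij[OF assms(1)]] this] show False
    using assms(2) by simp
qed

lemma bary_point_cases:
  assumes "\<not> collinear {A, B, C}"
  obtains p where "p \<noteq> 0" "X = bary_point A B C p"
proof -
  obtain v s where vs: "(v, s) \<noteq> (0, 0)" "X = hom_point v s"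
    by (rule hom_point_cases)
  obtain p where p: "(v, s) = (bary_vector A B C p, bary_weight p)"
    by (rule surjE[OF bij_is_surj[OF bary_bij[OF assms]]])
  have "p \<noteq> 0"
    using vs p by (auto simp: bary_vector_def bary_weight_def)
  with vs p show ?thesis
    using that[of p] by (simp add: bary_point_def)
qed

lemma bary_point_scale:
  assumes "c \<noteq> 0"
  shows "bary_point A B C (c *\<^sub>R p) = bary_point A B C p"
proof -
  have "bary_vector A B C (c *\<^sub>R p) = c *\<^sub>R bary_vector A B C p"
    "bary_weight (c *\<^sub>R p) = c * bary_weight p"
    by (simp_all add: bary_vector_def bary_weight_def algebra_simps)
  then show ?thesis
    using assms by (simp add: bary_point_def hom_point_scale)
qed

lemma bary_point_eqD:
  assumes nc: "\<not> collinear {A, B, C}" and "p \<noteq> 0" "q \<noteq> 0"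
    and "bary_point A B C p = bary_point A B C q"
  obtains c where "c \<noteq> 0" "q = c *\<^sub>R p"
proof -
  obtain c where c: "c \<noteq> 0" "bary_vector A B C q = c *\<^sub>R bary_vector A B C p"
      "bary_weight q = c * bary_weight p"
    using hom_point_eqD[OF bary_nonzero[OF nc \<open>p \<noteq> 0\<close>] bary_nonzero[OF nc \<open>q \<noteq> 0\<close>]] assms(4)
    unfolding bary_point_def by blast
  then have "(bary_vector A B C q, bary_weight q)
      = (bary_vector A B C (c *\<^sub>R p), bary_weight (c *\<^sub>R p))"
    by (simp add: bary_vector_def bary_weight_def algebra_simps)
  from injD[OF bij_is_inj[OF bary_bij[OF nc]] this] have "q = c *\<^sub>R p" .
  then show ?thesis using c that by blast
qed

lemma cross3_eq_0_iff_parallel: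
  assumes "p \<noteq> 0"
  shows "p \<times> q = 0 \<longleftrightarrow> (\<exists>c. q = c *\<^sub>R p)"
  using assms by (auto simp: cross_eq_0 collinear_lemma)

text \<open>The vector product expresses proportionality of coordinates without an existential quantifier.\<close>

lemma bary_point_eq_iff:
  assumes "\<not> collinear {A, B, C}" "p \<noteq> 0" "q \<noteq> 0"
  shows "bary_point A B C p = bary_point A B C q \<longleftrightarrow> p \<times> q = 0"
proof
  assume "bary_point A B C p = bary_point A B C q"
  then show "p \<times> q = 0"
    using bary_point_eqD[OF assms] by (metis cross_mult_right cross_refl scaleR_zero_right)
next
  assume "p \<times> q = 0"
  then obtain c where "q = c *\<^sub>R p"
    using assms by (auto simp: cross3_eq_0_iff_parallel)
  then show "bary_point A B C p = bary_point A B C q"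
    using assms bary_point_scale[of c A B C p] by fastforce
qed

lemma bary_point_in_line_iff:
  assumes "\<not> collinear {A, B, C}" "p \<noteq> 0"
  shows "bary_point A B C p \<in> bary_line A B C u \<longleftrightarrow> u \<bullet> p = 0"
proof
  assume "bary_point A B C p \<in> bary_line A B C u"
  then obtain q where "q \<noteq> 0" "u \<bullet> q = 0" "bary_point A B C q = bary_point A B C p"
    by (auto simp: bary_line_def)
  then show "u \<bullet> p = 0"
    using bary_point_eqD[OF assms(1) \<open>q \<noteq> 0\<close> \<open>p \<noteq> 0\<close>] by (metis inner_scaleR_right mult_zero_right)
qed (use assms in \<open>auto simp: bary_line_def\<close>)

lemma bary_line_eq_hom_line:
  assumes "\<not> collinear {A, B, C}"
    and "\<And>p. u \<bullet> p = a \<bullet> bary_vector A B C p - b * bary_weight p"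
  shows "bary_line A B C u = hom_line a b"
proof
  show "bary_line A B C u \<subseteq> hom_line a b"
    using bary_nonzero[OF assms(1)] assms(2)
    unfolding bary_line_def hom_line_def bary_point_def by force
  show "hom_line a b \<subseteq> bary_line A B C u"
  proof
    fix X assume X: "X \<in> hom_line a b"
    obtain p where p: "p \<noteq> 0" "X = bary_point A B C p"
      by (rule bary_point_cases[OF assms(1)])
    obtain v s where vs: "(v, s) \<noteq> (0, 0)" "a \<bullet> v = b * s" "X = hom_point v s"
      using X by (auto simp: hom_line_def)
    have "hom_point v s = hom_point (bary_vector A B C p) (bary_weight p)"
      using p vs by (simp add: bary_point_def)
    then obtain c where "c \<noteq> 0" "bary_vector A B C p = c *\<^sub>R v" "bary_weight p = c * s"
      using hom_point_eqD[OF vs(1) bary_nonzero[OF assms(1) p(1)]] by metis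
    then have "u \<bullet> p = 0"
      using vs(2) assms(2) by simp
    then show "X \<in> bary_line A B C u"
      using p by (auto simp: bary_line_def)
  qed
qed

lemma xlines_eq_bary_lines:
  assumes "\<not> collinear {A, B, C}"
  shows "xlines = {bary_line A B C u | u. u \<noteq> 0}"
proof safe
  fix l assume "l \<in> xlines"
  then obtain a b where ab: "(a, b) \<noteq> (0, 0)" "l = hom_line a b"
    by (auto simp: xlines_eq)
  define u :: "real^3" where "u = vector [a \<bullet> A - b, a \<bullet> B - b, a \<bullet> C - b]"
  have u: "u \<bullet> p = a \<bullet> bary_vector A B C p - b * bary_weight p" for p
    by (simp add: u_def inner_vec3 bary_vector_def bary_weight_def algebra_simps)
  have "u \<noteq> 0"
  proof
    assume "u = 0"
    obtain p where "(a, - b) = (bary_vector A B C p, bary_weight p)"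
      by (rule surjE[OF bij_is_surj[OF bary_bij[OF assms]]])
    then have "bary_vector A B C p = a" "bary_weight p = - b"
      by simp_all
    with u[of p] \<open>u = 0\<close> have "a \<bullet> a + b * b = 0"
      by simp
    then show False
      using ab(1) by (smt (verit) inner_eq_zero_iff inner_ge_zero mult_eq_0_iff zero_le_square)
  qed
  then show "\<exists>u. l = bary_line A B C u \<and> u \<noteq> 0"
    using bary_line_eq_hom_line[OF assms u] ab(2) by blast
next
  fix u :: "real^3" assume "u \<noteq> 0"
  obtain a b where ab: "\<And>p. u \<bullet> p = a \<bullet> bary_vector A B C p - b * bary_weight p"
    by (rule bary_functional_exists[OF assms, of u]) (rule that)
  have "(a, b) \<noteq> (0, 0)"
    using \<open>u \<noteq> 0\<close> ab[of u] by auto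
  then show "bary_line A B C u \<in> xlines"
    using bary_line_eq_hom_line[OF assms ab] by (auto simp: xlines_eq)
qed

text \<open>This gives the uniqueness of both the line through two points and the common point of two lines.\<close>

lemma orthogonal_to_both_eq_scaled_cross3:
  fixes u p q :: "real^3"
  assumes "u \<bullet> p = 0" "u \<bullet> q = 0" "p \<times> q \<noteq> 0"
  obtains c where "u = c *\<^sub>R (p \<times> q)"
proof -
  have "(p \<times> q) \<times> u = 0"
    using Lagrange[of u p q] assms cross_skew[of u "p \<times> q"] by simp
  then show ?thesis
    using that assms(3) by (auto simp: cross3_eq_0_iff_parallel)
qed

lemma join_bary_points:
  assumes nc: "\<not> collinear {A, B, C}" and "p \<times> q \<noteq> 0"
  shows "join (bary_point A B C p) (bary_point A B C q) = bary_line A B C (p \<times> q)"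
  unfolding join_def
proof (rule the_equality)
  have [simp]: "p \<noteq> 0" "q \<noteq> 0"
    using assms(2) by auto
  show "bary_line A B C (p \<times> q) \<in> xlines \<and>
      bary_point A B C p \<in> bary_line A B C (p \<times> q) \<and> bary_point A B C q \<in> bary_line A B C (p \<times> q)"
    using assms by (auto simp: xlines_eq_bary_lines bary_point_in_line_iff dot_cross_self inner_commute)
  fix l
  assume "l \<in> xlines \<and> bary_point A B C p \<in> l \<and> bary_point A B C q \<in> l"
  then obtain u where u: "u \<noteq> 0" "l = bary_line A B C u" "u \<bullet> p = 0" "u \<bullet> q = 0"
    using nc by (auto simp: xlines_eq_bary_lines bary_point_in_line_iff)
  obtain c where "u = c *\<^sub>R (p \<times> q)"
    using orthogonal_to_both_eq_scaled_cross3[OF u(3,4) assms(2)] by blast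
  then show "l = bary_line A B C (p \<times> q)"
    using u(1,2) by (simp add: bary_line_def)
qed

lemma meet_bary_lines:
  assumes nc: "\<not> collinear {A, B, C}" and "u \<times> v \<noteq> 0"
  shows "meet (bary_line A B C u) (bary_line A B C v) = bary_point A B C (u \<times> v)"
  unfolding meet_def
proof (rule the_equality)
  show "bary_point A B C (u \<times> v) \<in> bary_line A B C u \<and> bary_point A B C (u \<times> v) \<in> bary_line A B C v"
    using assms by (auto simp: bary_point_in_line_iff dot_cross_self)
  fix X
  assume X: "X \<in> bary_line A B C u \<and> X \<in> bary_line A B C v"
  obtain p where p: "p \<noteq> 0" "X = bary_point A B C p"
    by (rule bary_point_cases[OF nc])
  then have "p \<bullet> u = 0" "p \<bullet> v = 0"
    using X nc by (auto simp: bary_point_in_line_iff inner_commute)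
  then obtain c where "p = c *\<^sub>R (u \<times> v)"
    using orthogonal_to_both_eq_scaled_cross3 assms(2) by blast
  then show "X = bary_point A B C (u \<times> v)"
    using p bary_point_scale[of c] by fastforce
qed

section \<open>Traces, isotomic conjugates and triangle maps in coordinates\<close>

lemma cross3_vector:
  "vector [a, b, c] \<times> vector [x, y, z] =
     vector [b * z - c * y, c * x - a * z, a * y - b * x]"
  by (simp add: vec3_eq_iff cross_components)

lemma vector3_eq_0_iff: "vector [x, y, z] = (0 :: real^3) \<longleftrightarrow> x = 0 \<and> y = 0 \<and> z = 0"
  by (simp add: vec3_eq_iff)

lemma vector3_cases:
  obtains x y z where "p = (vector [x, y, z] :: real^3)"
proof -
  have "p = vector [p$1, p$2, p$3]"
    by (simp add: vec3_eq_iff)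
  then show ?thesis by (rule that)
qed

lemma bary_point_ordinary:
  assumes "bary_weight p \<noteq> 0"
  shows "bary_point A B C p = Ordinary (bary_vector A B C p /\<^sub>R bary_weight p)"
  using assms by (simp add: bary_point_def hom_point_def)

lemma ordinary_bary_point_iff: "ordinary (bary_point A B C p) \<longleftrightarrow> bary_weight p \<noteq> 0"
  by (auto simp: bary_point_def hom_point_def ordinary_def)

lemma Ordinary_vertex:
  "Ordinary A = bary_point A B C (vector [1, 0, 0])"
  "Ordinary B = bary_point A B C (vector [0, 1, 0])"
  "Ordinary C = bary_point A B C (vector [0, 0, 1])"
  by (simp_all add: bary_point_ordinary bary_weight_def bary_vector_def)

text \<open>Lets facts about the vertex \<open>A\<close> be transferred to \<open>B\<close> and \<open>C\<close> by permuting the triangle.\<close>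

lemma bary_point_cyclic:
  "bary_point B C A (vector [y, z, x]) = bary_point A B C (vector [x, y, z])"
  "bary_point C A B (vector [z, x, y]) = bary_point A B C (vector [x, y, z])"
  by (simp_all add: bary_point_def bary_weight_def bary_vector_def algebra_simps)

lemma not_collinear_cyclic:
  assumes "\<not> collinear {A, B, C}"
  shows "\<not> collinear {B, C, A}" "\<not> collinear {C, A, B}"
  using assms by (simp_all add: insert_commute)

lemma join_vertices:
  assumes "\<not> collinear {A, B, C}"
  shows "join (Ordinary B) (Ordinary C) = bary_line A B C (vector [1, 0, 0])"
  unfolding Ordinary_vertex[where A = A and B = B and C = C]
  by (subst join_bary_points[OF assms]) (simp_all add: cross3_vector vector3_eq_0_iff)

lemma cevian_trace_bary:
  assumes "\<not> collinear {A, B, C}" "y + z \<noteq> 0"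
  shows "cevian_trace A B C (bary_point A B C (vector [x, y, z])) = bary_point A B C (vector [0, y, z])"
proof -
  have "join (Ordinary A) (bary_point A B C (vector [x, y, z])) = bary_line A B C (vector [0, - z, y])"
    unfolding Ordinary_vertex(1)[where A = A and B = B and C = C] using assms
    by (subst join_bary_points) (auto simp: cross3_vector vector3_eq_0_iff)
  then show ?thesis
    unfolding cevian_trace_def join_vertices[OF assms(1)] using assms
    by (simp add: meet_bary_lines cross3_vector vector3_eq_0_iff; force)
qed

lemma cevian_trace_eq:
  assumes "\<not> collinear {A, B, C}" "y + z \<noteq> 0"
  shows "cevian_trace A B C (bary_point A B C (vector [x, y, z]))
    = Ordinary ((y *\<^sub>R B + z *\<^sub>R C) /\<^sub>R (y + z))"
  using assms
  by (simp add: cevian_trace_bary bary_point_ordinary bary_weight_def bary_vector_def)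

lemma refl_trace_eq:
  assumes "\<not> collinear {A, B, C}" "y + z \<noteq> 0"
  shows "refl_trace A B C (bary_point A B C (vector [x, y, z]))
    = Ordinary ((z *\<^sub>R B + y *\<^sub>R C) /\<^sub>R (y + z))"
proof -
  have "homothety (midpoint B C) (- 1) X = B + C - X" for X
    by (simp add: homothety_def midpoint_def vec_eq_iff field_simps)
  moreover have "B + C = ((y + z) *\<^sub>R (B + C)) /\<^sub>R (y + z)"
    using assms(2) by simp
  moreover have "(y + z) *\<^sub>R (B + C) - (y *\<^sub>R B + z *\<^sub>R C) = z *\<^sub>R B + y *\<^sub>R C"
    by (simp add: algebra_simps)
  \<comment> \<open>A half-turn about the midpoint swaps the weights of the two vertices.\<close>
  ultimately have "homothety (midpoint B C) (- 1) ((y *\<^sub>R B + z *\<^sub>R C) /\<^sub>R (y + z))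
      = (z *\<^sub>R B + y *\<^sub>R C) /\<^sub>R (y + z)"
    by (metis scaleR_diff_right)
  then show ?thesis
    by (simp add: refl_trace_def cevian_trace_eq[OF assms])
qed

text \<open>The cevian through the reflected trace \<open>(0 : z : y)\<close> is the line \<open>- y b + z c = 0\<close>.\<close>

lemma bary_point_in_isotomic_cevian_iff:
  assumes "\<not> collinear {A, B, C}" "y + z \<noteq> 0" "vector [a, b, c] \<noteq> (0 :: real^3)"
  shows "bary_point A B C (vector [a, b, c])
      \<in> join (Ordinary A) (refl_trace A B C (bary_point A B C (vector [x, y, z])))
    \<longleftrightarrow> y * b = z * c"
proof -
  have "refl_trace A B C (bary_point A B C (vector [x, y, z])) = bary_point A B C (vector [0, z, y])"
    using assms(2) by (simp add: refl_trace_eq[OF assms(1,2)] bary_point_ordinary bary_weight_def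
        bary_vector_def add.commute)
  then have "join (Ordinary A) (refl_trace A B C (bary_point A B C (vector [x, y, z])))
      = bary_line A B C (vector [0, - y, z])"
    unfolding Ordinary_vertex(1)[where A = A and B = B and C = C] using assms(1,2)
    by simp (subst join_bary_points, auto simp: cross3_vector vector3_eq_0_iff)
  then show ?thesis
    using assms(1,3) by (auto simp: bary_point_in_line_iff inner_vec3)
qed

text \<open>The three isotomic cevians have the equations \<open>y b = z c\<close>, \<open>z c = x a\<close> and \<open>x a = y b\<close>; their common
point is \<open>(1/x : 1/y : 1/z)\<close>, written below without denominators.\<close>

lemma isotomic_conjugate_bary:
  assumes nc: "\<not> collinear {A, B, C}" and nz: "x \<noteq> 0" "y \<noteq> 0" "z \<noteq> 0"
    and sums: "y + z \<noteq> 0" "z + x \<noteq> 0" "x + y \<noteq> 0"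
  shows "isotomic_conjugate A B C (bary_point A B C (vector [x, y, z]))
    = bary_point A B C (vector [y * z, z * x, x * y])"
proof -
  let ?P = "bary_point A B C (vector [x, y, z])"
  have on_cevians: "bary_point A B C (vector [a, b, c]) \<in> join (Ordinary A) (refl_trace A B C ?P)
      \<and> bary_point A B C (vector [a, b, c]) \<in> join (Ordinary B) (refl_trace B C A ?P)
      \<and> bary_point A B C (vector [a, b, c]) \<in> join (Ordinary C) (refl_trace C A B ?P)
    \<longleftrightarrow> y * b = z * c \<and> z * c = x * a \<and> x * a = y * b"
    if abc: "vector [a, b, c] \<noteq> (0 :: real^3)" for a b c
  proof -
    have abc': "vector [b, c, a] \<noteq> (0 :: real^3)" "vector [c, a, b] \<noteq> (0 :: real^3)"
      using abc by (auto simp: vector3_eq_0_iff)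
    show ?thesis
      using bary_point_in_isotomic_cevian_iff[OF nc sums(1) abc, of x]
        bary_point_in_isotomic_cevian_iff[OF not_collinear_cyclic(1)[OF nc] sums(2) abc'(1), of y]
        bary_point_in_isotomic_cevian_iff[OF not_collinear_cyclic(2)[OF nc] sums(3) abc'(2), of z]
      unfolding bary_point_cyclic[where A = A and B = B and C = C] by blast
  qed
  show ?thesis
    unfolding isotomic_conjugate_def
  proof (rule the_equality)
    have "vector [y * z, z * x, x * y] \<noteq> (0 :: real^3)"
      using nz by (simp add: vector3_eq_0_iff)
    from on_cevians[OF this]
    show "bary_point A B C (vector [y * z, z * x, x * y]) \<in> join (Ordinary A) (refl_trace A B C ?P)
      \<and> bary_point A B C (vector [y * z, z * x, x * y]) \<in> join (Ordinary B) (refl_trace B C A ?P)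
      \<and> bary_point A B C (vector [y * z, z * x, x * y]) \<in> join (Ordinary C) (refl_trace C A B ?P)"
      by (simp add: mult_ac)
    fix X
    assume X: "X \<in> join (Ordinary A) (refl_trace A B C ?P)
      \<and> X \<in> join (Ordinary B) (refl_trace B C A ?P) \<and> X \<in> join (Ordinary C) (refl_trace C A B ?P)"
    obtain q where q: "q \<noteq> 0" "X = bary_point A B C q"
      by (rule bary_point_cases[OF nc])
    obtain a b c where abc: "q = vector [a, b, c]"
      by (rule vector3_cases)
    have "y * b = z * c \<and> z * c = x * a \<and> x * a = y * b"
      by (rule iffD1[OF on_cevians]) (use X q abc in simp_all)
    then have eqs: "y * b = x * a" "z * c = x * a"
      by metis+
    have "b * (x * y) = x * (y * b)" "c * (z * x) = x * (z * c)" "c * (y * z) = y * (z * c)"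
      "a * (x * y) = y * (x * a)" "a * (z * x) = z * (x * a)" "b * (y * z) = z * (y * b)"
      by (simp_all add: mult_ac)
    then have "b * (x * y) = c * (z * x)" "c * (y * z) = a * (x * y)" "a * (z * x) = b * (y * z)"
      by (simp_all only: eqs)
    then have "q \<times> vector [y * z, z * x, x * y] = 0"
      by (simp add: abc cross3_vector vector3_eq_0_iff)
    then show "X = bary_point A B C (vector [y * z, z * x, x * y])"
      using q nc nz by (simp add: bary_point_eq_iff vector3_eq_0_iff)
  qed
qed

text \<open>Affine maps preserve normalised barycentric coordinates. This proves that an affine map is determined
by its values on a triangle.\<close>

lemma affine_map_bary_vector:
  assumes "affine_map T" "bary_weight p = 1"
  shows "T (bary_vector A B C p) = bary_vector (T A) (T B) (T C) p"
proof -
  obtain L c where L: "linear L" and T: "T = (\<lambda>x. L x + c)"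
    using assms(1) by (auto simp: affine_map_def)
  have "bary_vector (T A) (T B) (T C) p = bary_vector (L A) (L B) (L C) p + bary_weight p *\<^sub>R c"
    by (simp add: T bary_vector_def bary_weight_def algebra_simps)
  moreover have "L (bary_vector A B C p) = bary_vector (L A) (L B) (L C) p"
    by (simp add: bary_vector_def linear_add[OF L] linear_scale[OF L])
  ultimately show ?thesis
    using assms(2) by (simp add: T)
qed

text \<open>The map replaces \<open>A\<close>, \<open>B\<close>, \<open>C\<close> by \<open>D\<close>, \<open>E\<close>, \<open>F\<close> in the barycentric representation of a point.\<close>

lemma affine_map_exists:
  assumes nc: "\<not> collinear {A, B, C}"
  obtains T where "affine_map T" "T A = D" "T B = E" "T C = F"
proof -
  let ?f = "\<lambda>p. (bary_vector A B C p, bary_weight p)"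
  obtain g where g: "linear g" "\<And>p. g (?f p) = p"
    using linear_injective_left_inverse[OF linear_bary bij_is_inj[OF bary_bij[OF nc]]]
    by (auto simp: fun_eq_iff)
  define T where "T = (\<lambda>w. bary_vector D E F (g (w, 1)))"
  have split: "g (w, 1) = g (w, 0) + g (0, 1)" for w
    using linear_add[OF g(1), of "(w, 0)" "(0, 1)"] by simp
  have "linear (\<lambda>w. bary_vector D E F (g (w, 0)))"
  proof (rule linearI)
    fix v w :: "real^2" and r :: real
    have "g (v + w, 0) = g (v, 0) + g (w, 0)"
      using linear_add[OF g(1), of "(v, 0)" "(w, 0)"] by simp
    then show "bary_vector D E F (g (v + w, 0)) = bary_vector D E F (g (v, 0)) + bary_vector D E F (g (w, 0))"
      by (simp add: bary_vector_def algebra_simps)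
    have "g (r *\<^sub>R v, 0) = r *\<^sub>R g (v, 0)"
      using linear_scale[OF g(1), of r "(v, 0)"] by simp
    then show "bary_vector D E F (g (r *\<^sub>R v, 0)) = r *\<^sub>R bary_vector D E F (g (v, 0))"
      by (simp add: bary_vector_def algebra_simps)
  qed
  moreover have "T = (\<lambda>w. bary_vector D E F (g (w, 0)) + bary_vector D E F (g (0, 1)))"
  proof
    fix w
    have "T w = bary_vector D E F (g (w, 0) + g (0, 1))"
      unfolding T_def by (simp only: split[of w])
    then show "T w = bary_vector D E F (g (w, 0)) + bary_vector D E F (g (0, 1))"
      by (simp add: bary_vector_def algebra_simps)
  qed
  ultimately have "affine_map T"
    unfolding affine_map_def by blast
  moreover have "T A = D" "T B = E" "T C = F"
    using g(2)[of "vector [1, 0, 0]"] g(2)[of "vector [0, 1, 0]"] g(2)[of "vector [0, 0, 1]"]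
    by (simp_all add: T_def bary_vector_def bary_weight_def)
  ultimately show ?thesis by (rule that)
qed

lemma triangle_map_centroid:
  assumes nc: "\<not> collinear {A, B, C}"
  shows "triangle_map A B C (Ordinary D) (Ordinary E) (Ordinary F) (centroid A B C) = centroid D E F"
proof -
  obtain T where T: "affine_map T" "T A = D" "T B = E" "T C = F"
    by (rule affine_map_exists[OF nc])
  have "triangle_map A B C (Ordinary D) (Ordinary E) (Ordinary F) = T"
    unfolding triangle_map_def
  proof (rule the_equality)
    fix S
    assume S: "affine_map S \<and> Ordinary (S A) = Ordinary D \<and> Ordinary (S B) = Ordinary E
      \<and> Ordinary (S C) = Ordinary F"
    show "S = T"
    proof
      fix w
      obtain p where p: "(w, 1) = (bary_vector A B C p, bary_weight p)"
        by (rule surjE[OF bij_is_surj[OF bary_bij[OF nc]]])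
      then show "S w = T w"
        using affine_map_bary_vector[of S p A B C] affine_map_bary_vector[of T p A B C] S T by simp
    qed
  qed (use T in simp)
  then show ?thesis
    using affine_map_centroid[OF T(1), of A B C] T by simp
qed

lemma xline_with_ordinary_point:
  assumes "l \<in> xlines" "X \<in> l" "ordinary X"
  shows "l \<in> ordinary_lines"
  using assms by (auto simp: xlines_def line_infty_def ordinary_def)

lemma join_bary_in_ordinary_lines:
  assumes nc: "\<not> collinear {A, B, C}" and "p \<times> q \<noteq> 0" and "bary_weight p \<noteq> 0 \<or> bary_weight q \<noteq> 0"
  shows "join (bary_point A B C p) (bary_point A B C q) \<in> ordinary_lines"
proof -
  have nz: "p \<noteq> 0" "q \<noteq> 0"
    using assms(2) by auto
  have "bary_line A B C (p \<times> q) \<in> xlines"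
    using nc assms(2) by (auto simp: xlines_eq_bary_lines)
  moreover have "bary_point A B C p \<in> bary_line A B C (p \<times> q)"
      "bary_point A B C q \<in> bary_line A B C (p \<times> q)"
    using nc nz by (simp_all add: bary_point_in_line_iff dot_cross_self)
  ultimately show ?thesis
    using assms(3) xline_with_ordinary_point
    unfolding join_bary_points[OF nc assms(2)] ordinary_bary_point_iff[of A B C, symmetric] by blast
qed

section \<open>Exceptional positions of a point\<close>

lemma on_side_iff:
  assumes "\<not> collinear {A, B, C}" "vector [x, y, z] \<noteq> (0 :: real^3)"
  shows "bary_point A B C (vector [x, y, z]) \<in> join (Ordinary B) (Ordinary C) \<longleftrightarrow> x = 0"
  unfolding join_vertices[OF assms(1)] bary_point_in_line_iff[OF assms] by (simp add: inner_vec3)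

lemma on_anticomplementary_side_iff:
  assumes nc: "\<not> collinear {A, B, C}" and "vector [x, y, z] \<noteq> (0 :: real^3)"
  shows "bary_point A B C (vector [x, y, z]) \<in> join (Ordinary (C + A - B)) (Ordinary (A + B - C))
    \<longleftrightarrow> y + z = 0"
proof -
  have "Ordinary (C + A - B) = bary_point A B C (vector [1, -1, 1])"
    "Ordinary (A + B - C) = bary_point A B C (vector [1, 1, -1])"
    by (simp_all add: bary_point_ordinary bary_weight_def bary_vector_def algebra_simps)
  then have "join (Ordinary (C + A - B)) (Ordinary (A + B - C)) = bary_line A B C (vector [0, 2, 2])"
    by (simp add: join_bary_points[OF nc] cross3_vector vector3_eq_0_iff)
  then show ?thesis
    by (simp add: bary_point_in_line_iff[OF assms] inner_vec3) linarith
qed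

lemma on_median_iff:
  assumes nc: "\<not> collinear {A, B, C}" and "vector [x, y, z] \<noteq> (0 :: real^3)"
  shows "bary_point A B C (vector [x, y, z]) \<in> join (Ordinary A) (Ordinary (centroid A B C))
    \<longleftrightarrow> y = z"
proof -
  have "Ordinary (centroid A B C) = bary_point A B C (vector [1, 1, 1])"
    by (simp add: bary_point_ordinary bary_weight_def bary_vector_def centroid_def)
  then have "join (Ordinary A) (Ordinary (centroid A B C)) = bary_line A B C (vector [0, - 1, 1])"
    unfolding Ordinary_vertex(1)[where A = A and B = B and C = C]
    by (simp add: join_bary_points[OF nc] cross3_vector vector3_eq_0_iff)
  then show ?thesis
    by (simp add: bary_point_in_line_iff[OF assms] inner_vec3) auto
qed

lemma vector3_cyclic_nonzero:
  assumes "vector [x, y, z] \<noteq> (0 :: real^3)"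
  shows "vector [y, z, x] \<noteq> (0 :: real^3)" "vector [z, x, y] \<noteq> (0 :: real^3)"
  using assms by (auto simp: vector3_eq_0_iff)

lemma on_sides_bary_iff:
  assumes nc: "\<not> collinear {A, B, C}" and nz: "vector [x, y, z] \<noteq> (0 :: real^3)"
  shows "on_sides A B C (bary_point A B C (vector [x, y, z])) \<longleftrightarrow> x = 0 \<or> y = 0 \<or> z = 0"
  unfolding on_sides_def
  using on_side_iff[OF nc nz]
    on_side_iff[OF not_collinear_cyclic(1)[OF nc] vector3_cyclic_nonzero(1)[OF nz]]
    on_side_iff[OF not_collinear_cyclic(2)[OF nc] vector3_cyclic_nonzero(2)[OF nz]]
  unfolding bary_point_cyclic[where A = A and B = B and C = C] by blast

lemma on_anticomplementary_sides_bary_iff: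
  assumes nc: "\<not> collinear {A, B, C}" and nz: "vector [x, y, z] \<noteq> (0 :: real^3)"
  shows "on_sides (B + C - A) (C + A - B) (A + B - C) (bary_point A B C (vector [x, y, z]))
    \<longleftrightarrow> y + z = 0 \<or> z + x = 0 \<or> x + y = 0"
  unfolding on_sides_def
  using on_anticomplementary_side_iff[OF nc nz]
    on_anticomplementary_side_iff[OF not_collinear_cyclic(1)[OF nc] vector3_cyclic_nonzero(1)[OF nz]]
    on_anticomplementary_side_iff[OF not_collinear_cyclic(2)[OF nc] vector3_cyclic_nonzero(2)[OF nz]]
  unfolding bary_point_cyclic[where A = A and B = B and C = C] by blast

lemma centroid_cyclic: "centroid B C A = centroid A B C" "centroid C A B = centroid A B C"
  by (simp_all add: centroid_def add_ac)

lemma on_medians_bary_iff: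
  assumes nc: "\<not> collinear {A, B, C}" and nz: "vector [x, y, z] \<noteq> (0 :: real^3)"
  shows "on_medians A B C (bary_point A B C (vector [x, y, z])) \<longleftrightarrow> y = z \<or> z = x \<or> x = y"
  unfolding on_medians_def Let_def
  using on_median_iff[OF nc nz]
    on_median_iff[OF not_collinear_cyclic(1)[OF nc] vector3_cyclic_nonzero(1)[OF nz]]
    on_median_iff[OF not_collinear_cyclic(2)[OF nc] vector3_cyclic_nonzero(2)[OF nz]]
  unfolding bary_point_cyclic[where A = A and B = B and C = C]
    centroid_cyclic[where A = A and B = B and C = C] by blast

lemma inv_complement_map:
  "inv (complement_map A B C) A = B + C - A"
  "inv (complement_map A B C) B = C + A - B"
  "inv (complement_map A B C) C = A + B - C"
proof -
  have "inj (complement_map A B C)"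
    by (auto simp: inj_def complement_map_def homothety_def)
  moreover have "complement_map A B C (B + C - A) = A" "complement_map A B C (C + A - B) = B"
    "complement_map A B C (A + B - C) = C"
    by (simp_all add: complement_map_def homothety_def centroid_def vec_eq_iff field_simps)
  ultimately show "inv (complement_map A B C) A = B + C - A"
    "inv (complement_map A B C) B = C + A - B" "inv (complement_map A B C) C = A + B - C"
    by (metis inv_f_eq)+
qed

section \<open>The centroids of the two cevian triangles\<close>

lemma centroid_cevian_map:
  assumes nc: "\<not> collinear {A, B, C}"
    and sums: "y + z \<noteq> 0" "z + x \<noteq> 0" "x + y \<noteq> 0"
  shows "cevian_map A B C (bary_point A B C (vector [x, y, z])) (centroid A B C) =
    centroid ((y *\<^sub>R B + z *\<^sub>R C) /\<^sub>R (y + z)) ((z *\<^sub>R C + x *\<^sub>R A) /\<^sub>R (z + x))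
      ((x *\<^sub>R A + y *\<^sub>R B) /\<^sub>R (x + y))"
  unfolding cevian_map_def
  using cevian_trace_eq[OF nc sums(1), of x]
    cevian_trace_eq[OF not_collinear_cyclic(1)[OF nc] sums(2), of y]
    cevian_trace_eq[OF not_collinear_cyclic(2)[OF nc] sums(3), of z]
  unfolding bary_point_cyclic[where A = A and B = B and C = C]
  by (simp add: triangle_map_centroid[OF nc])

lemma centroid_isotomic_cevian_map:
  assumes nc: "\<not> collinear {A, B, C}"
    and sums: "y + z \<noteq> 0" "z + x \<noteq> 0" "x + y \<noteq> 0"
  shows "isotomic_cevian_map A B C (bary_point A B C (vector [x, y, z])) (centroid A B C) =
    centroid ((z *\<^sub>R B + y *\<^sub>R C) /\<^sub>R (y + z)) ((x *\<^sub>R C + z *\<^sub>R A) /\<^sub>R (z + x))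
      ((y *\<^sub>R A + x *\<^sub>R B) /\<^sub>R (x + y))"
  unfolding isotomic_cevian_map_def
  using refl_trace_eq[OF nc sums(1), of x]
    refl_trace_eq[OF not_collinear_cyclic(1)[OF nc] sums(2), of y]
    refl_trace_eq[OF not_collinear_cyclic(2)[OF nc] sums(3), of z]
  unfolding bary_point_cyclic[where A = A and B = B and C = C]
  by (simp add: triangle_map_centroid[OF nc])

text \<open>Coordinates of the infinite point of the line through \<open>(x : y : z)\<close> and its isotomic conjugate: the
coefficients are chosen to cancel the two coordinate sums.\<close>

definition isotomic_direction :: "real \<Rightarrow> real \<Rightarrow> real \<Rightarrow> real^3" where
  "isotomic_direction x y z =
     (x * y + y * z + z * x) *\<^sub>R vector [x, y, z] - (x + y + z) *\<^sub>R vector [y * z, z * x, x * y]"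

lemma isotomic_direction_eq:
  "isotomic_direction x y z = vector [(x\<^sup>2 - y * z) * (y + z), (y\<^sup>2 - z * x) * (z + x), (z\<^sup>2 - x * y) * (x + y)]"
  by (simp add: isotomic_direction_def vec3_eq_iff power2_eq_square algebra_simps)

lemma bary_weight_isotomic_direction: "bary_weight (isotomic_direction x y z) = 0"
  by (simp add: isotomic_direction_eq bary_weight_def power2_eq_square algebra_simps)

text \<open>The equations \<open>x\<^sup>2 = yz\<close>, \<open>y\<^sup>2 = zx\<close>, \<open>z\<^sup>2 = xy\<close> add up to
\<open>(x - y)\<^sup>2 + (y - z)\<^sup>2 + (z - x)\<^sup>2 = 0\<close>.\<close>

lemma isotomic_direction_nonzero:
  assumes sums: "y + z \<noteq> 0" "z + x \<noteq> 0" "x + y \<noteq> 0" and ne: "\<not> (x = y \<and> y = z)"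
  shows "isotomic_direction x y z \<noteq> 0"
proof
  assume "isotomic_direction x y z = 0"
  then have "x\<^sup>2 = y * z" "y\<^sup>2 = z * x" "z\<^sup>2 = x * y"
    using sums by (simp_all add: isotomic_direction_eq vector3_eq_0_iff)
  then have "(x - y)\<^sup>2 + (y - z)\<^sup>2 + (z - x)\<^sup>2 = 0"
    by (simp add: power2_diff)
  then have "(x - y)\<^sup>2 = 0" "(y - z)\<^sup>2 = 0"
    by (smt (verit) zero_le_power2)+
  then show False
    using ne by simp
qed

lemma isotomic_points_distinct:
  assumes nz: "x \<noteq> 0" "y \<noteq> 0" "z \<noteq> (0::real)"
    and sums: "y + z \<noteq> 0" "z + x \<noteq> 0" "x + y \<noteq> 0" and ne: "\<not> (x = y \<and> y = z)"
  shows "vector [x, y, z] \<times> vector [y * z, z * x, x * y] \<noteq> 0"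
proof
  assume "vector [x, y, z] \<times> vector [y * z, z * x, x * y] = 0"
  then have "x * (y * y - z * z) = 0" "z * (x * x - y * y) = 0"
    by (simp_all add: cross3_vector vector3_eq_0_iff algebra_simps)
  then have "(y - z) * (y + z) = 0" "(x - y) * (x + y) = 0"
    using nz by (simp_all add: algebra_simps)
  then show False
    using sums ne by simp
qed

text \<open>The left-hand side is the weight of \<open>A\<close> in \<open>D + E + F\<close>. The fraction on the right is not in lowest terms
so that its denominator is symmetric under cyclic permutations.\<close>

lemma cevian_triangle_weights:
  assumes "y + z \<noteq> 0" "z + x \<noteq> 0" "x + y \<noteq> (0 :: real)"
  shows "x / (z + x) + x / (x + y) = 1 + (x\<^sup>2 - y * z) * (y + z) / ((x + y) * (y + z) * (z + x))"
proof -
  have "(x\<^sup>2 - y * z) * (y + z) / ((x + y) * (y + z) * (z + x)) = (x\<^sup>2 - y * z) / ((x + y) * (z + x))"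
    using assms(1) by simp
  moreover have "x / (z + x) + x / (x + y) = ((x + y) * (z + x) + (x\<^sup>2 - y * z)) / ((x + y) * (z + x))"
    using assms by (simp add: add_frac_eq power2_eq_square algebra_simps)
  ultimately show ?thesis
    using assms by (simp add: add_divide_distrib)
qed

text \<open>The centroid of the cevian triangle is displaced from that of \<open>ABC\<close> in the direction of \<open>PP'\<close>.\<close>

lemma centroid_of_cevian_triangle:
  fixes A B C :: "real^2"
  assumes "y + z \<noteq> 0" "z + x \<noteq> 0" "x + y \<noteq> 0"
  shows "centroid ((y *\<^sub>R B + z *\<^sub>R C) /\<^sub>R (y + z)) ((z *\<^sub>R C + x *\<^sub>R A) /\<^sub>R (z + x))
      ((x *\<^sub>R A + y *\<^sub>R B) /\<^sub>R (x + y))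
    = centroid A B C
      + (1 / (3 * ((x + y) * (y + z) * (z + x)))) *\<^sub>R bary_vector A B C (isotomic_direction x y z)"
proof -
  define m where "m = (x + y) * (y + z) * (z + x)"
  have "x / (z + x) + x / (x + y) = 1 + (x\<^sup>2 - y * z) * (y + z) / m"
    "y / (x + y) + y / (y + z) = 1 + (y\<^sup>2 - z * x) * (z + x) / m"
    "z / (y + z) + z / (z + x) = 1 + (z\<^sup>2 - x * y) * (x + y) / m"
    using cevian_triangle_weights[of y z x] cevian_triangle_weights[of z x y]
      cevian_triangle_weights[of x y z] assms
    by (simp_all add: m_def mult_ac)
  note weights = this
  have "(y *\<^sub>R B + z *\<^sub>R C) /\<^sub>R (y + z) + (z *\<^sub>R C + x *\<^sub>R A) /\<^sub>R (z + x) + (x *\<^sub>R A + y *\<^sub>R B) /\<^sub>R (x + y)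
    = (x / (z + x) + x / (x + y)) *\<^sub>R A + (y / (x + y) + y / (y + z)) *\<^sub>R B
      + (z / (y + z) + z / (z + x)) *\<^sub>R C"
    by (simp add: scaleR_add_left scaleR_add_right divide_inverse mult.commute)
  also have "\<dots> = A + B + C + (1 / m) *\<^sub>R bary_vector A B C (isotomic_direction x y z)"
    unfolding weights
    by (simp add: isotomic_direction_eq bary_vector_def scaleR_add_left scaleR_add_right)
  finally have *: "(y *\<^sub>R B + z *\<^sub>R C) /\<^sub>R (y + z) + (z *\<^sub>R C + x *\<^sub>R A) /\<^sub>R (z + x) + (x *\<^sub>R A + y *\<^sub>R B) /\<^sub>R (x + y)
    = A + B + C + (1 / m) *\<^sub>R bary_vector A B C (isotomic_direction x y z)" .
  show ?thesis
    unfolding centroid_def * by (simp add: m_def scaleR_add_right)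
qed

text \<open>Each trace and its reflection in the midpoint of the side add up to the sum of the two end points
of the side.\<close>

lemma centroid_of_isotomic_cevian_triangle:
  fixes A B C :: "real^2"
  assumes "y + z \<noteq> 0" "z + x \<noteq> 0" "x + y \<noteq> 0"
  shows "centroid ((y *\<^sub>R B + z *\<^sub>R C) /\<^sub>R (y + z)) ((z *\<^sub>R C + x *\<^sub>R A) /\<^sub>R (z + x))
      ((x *\<^sub>R A + y *\<^sub>R B) /\<^sub>R (x + y))
    + centroid ((z *\<^sub>R B + y *\<^sub>R C) /\<^sub>R (y + z)) ((x *\<^sub>R C + z *\<^sub>R A) /\<^sub>R (z + x))
      ((y *\<^sub>R A + x *\<^sub>R B) /\<^sub>R (x + y))
    = 2 *\<^sub>R centroid A B C"
proof -
  have *: "(s *\<^sub>R U + t *\<^sub>R V) /\<^sub>R (s + t) + (t *\<^sub>R U + s *\<^sub>R V) /\<^sub>R (s + t) = U + V"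
    if "s + t \<noteq> 0" for s t and U V :: "real^2"
  proof -
    have "(s *\<^sub>R U + t *\<^sub>R V) + (t *\<^sub>R U + s *\<^sub>R V) = (s + t) *\<^sub>R (U + V)"
      by (simp add: algebra_simps)
    then show ?thesis
      using that by (simp flip: scaleR_add_right)
  qed
  have sum: "centroid D E F + centroid D' E' F' = (1/3) *\<^sub>R ((D + D') + (E + E') + (F + F'))"
    for D E F D' E' F' :: "real^2"
    by (simp add: centroid_def scaleR_add_right)
  show ?thesis
    unfolding sum *[OF assms(1)] *[OF assms(2)] *[OF assms(3)]
    by (simp add: centroid_def vec_eq_iff)
qed

section \<open>The affine reflection in the triangle \<open>GPP'\<close>\<close>

text \<open>Applied with \<open>X = P\<close> and \<open>Y = P'\<close>, so that \<open>K Y = Q\<close> and \<open>K X = Q'\<close>. All points are expressed in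
barycentric coordinates for the triangle \<open>GXY\<close>: \<open>V\<close> becomes \<open>(3 : -1 : -1)\<close>, the center
\<open>(0 : 1 : -1)\<close>, and the axis consists of the points whose last two coordinates agree.\<close>

lemma harmonic_homology_on_parallel:
  fixes G X Y :: "real^2"
  assumes nc: "\<not> collinear {G, X, Y}" and "t \<noteq> 0"
  defines "K \<equiv> homothety G (- 1 / 2)"
  shows "harmonic_homology
      (meet (join (Ordinary X) (Ordinary Y)) (join (Ordinary (K Y)) (Ordinary (K X))))
      (join (Ordinary G)
        (meet (join (Ordinary X) (Ordinary (K Y))) (join (Ordinary Y) (Ordinary (K X)))))
      (G + t *\<^sub>R (X - Y)) = G - t *\<^sub>R (X - Y)"
proof -
  let ?pt = "bary_point G X Y" and ?ln = "bary_line G X Y"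
  note join = join_bary_points[OF nc] and meet = meet_bary_lines[OF nc]
  have pt1: "?pt (vector [1 - b - c, b, c]) = Ordinary (G + b *\<^sub>R (X - G) + c *\<^sub>R (Y - G))" for b c
    by (simp add: bary_point_ordinary bary_weight_def bary_vector_def algebra_simps)
  have KY: "Ordinary (K Y) = ?pt (vector [3/2, 0, -1/2])"
    using pt1[of 0 "-1/2"] by (simp add: K_def homothety_def)
  have KX: "Ordinary (K X) = ?pt (vector [3/2, -1/2, 0])"
    using pt1[of "-1/2" 0] by (simp add: K_def homothety_def)
  have V: "meet (join (Ordinary X) (Ordinary (K Y))) (join (Ordinary Y) (Ordinary (K X)))
      = ?pt (vector [9/4, -3/4, -3/4])"
    unfolding KX KY Ordinary_vertex(2,3)[where A = G and B = X and C = Y]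
    by (simp add: join meet cross3_vector vector3_eq_0_iff)
  have axis: "join (Ordinary G) (?pt (vector [9/4, -3/4, -3/4])) = ?ln (vector [0, 3/4, -3/4])"
    unfolding Ordinary_vertex(1)[where A = G and B = X and C = Y]
    by (simp add: join cross3_vector vector3_eq_0_iff)
  have Vinf: "meet (join (Ordinary X) (Ordinary Y)) (join (Ordinary (K Y)) (Ordinary (K X)))
      = ?pt (vector [0, 3/4, -3/4])"
    unfolding KX KY Ordinary_vertex(2,3)[where A = G and B = X and C = Y]
    by (simp add: join meet cross3_vector vector3_eq_0_iff)
  \<comment> \<open>The vector product yields multiples by \<open>3/4\<close> of small integer vectors; by coincidence the center, as a point, and the axis, as a line, have the same coordinates.\<close>
  have on_axis: "Ordinary (G + b *\<^sub>R (X - G) + c *\<^sub>R (Y - G)) \<in> ?ln (vector [0, 3/4, -3/4]) \<longleftrightarrow> b = c"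
    for b c
    unfolding pt1[symmetric] using nc
    by (subst bary_point_in_line_iff) (auto simp: vector3_eq_0_iff inner_vec3)
  have G1: "G + t *\<^sub>R (X - Y) = G + t *\<^sub>R (X - G) + (- t) *\<^sub>R (Y - G)"
    by (simp add: algebra_simps)
  have G2: "G - t *\<^sub>R (X - Y) = G + (- t) *\<^sub>R (X - G) + t *\<^sub>R (Y - G)"
    by (simp add: algebra_simps)
  have off_axis: "Ordinary (G + t *\<^sub>R (X - Y)) \<notin> ?ln (vector [0, 3/4, -3/4])"
    unfolding G1 on_axis using \<open>t \<noteq> 0\<close> by simp
  have mid: "Ordinary (midpoint (G + t *\<^sub>R (X - Y)) (G + b *\<^sub>R (X - G) + c *\<^sub>R (Y - G)))
      \<in> ?ln (vector [0, 3/4, -3/4]) \<longleftrightarrow> t + b = c - t" for b c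
  proof -
    have "midpoint (G + t *\<^sub>R (X - Y)) (G + b *\<^sub>R (X - G) + c *\<^sub>R (Y - G))
      = G + ((t + b) / 2) *\<^sub>R (X - G) + ((c - t) / 2) *\<^sub>R (Y - G)"
      by (simp add: midpoint_def vec_eq_iff field_simps)
    then show ?thesis
      by (simp only: on_axis) (auto simp: field_simps)
  qed
  have par: "?pt (vector [0, 3/4, -3/4])
      \<in> join (Ordinary (G + t *\<^sub>R (X - Y))) (Ordinary (G + b *\<^sub>R (X - G) + c *\<^sub>R (Y - G)))
    \<longleftrightarrow> b + c = 0" if ne: "b \<noteq> t \<or> c \<noteq> - t" for b c
  proof -
    let ?u = "vector [1 - t - (- t), t, - t] \<times> vector [1 - b - c, b, c]"
    have u: "?u \<noteq> 0"
    proof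
      assume "?u = 0"
      then have "t * c + t * b = 0" "- t * (1 - b - c) - c = 0" "b - t * (1 - b - c) = 0"
        by (simp_all add: cross3_vector vector3_eq_0_iff)
      then show False
        using ne \<open>t \<noteq> 0\<close> by algebra
    qed
    have v: "vector [0, 3/4, -3/4] \<noteq> (0 :: real^3)"
      by (simp add: vector3_eq_0_iff)
    have uv: "?u \<bullet> vector [0, 3/4, -3/4] = - (3/4) * (b + c)"
      by (simp add: cross3_vector inner_vec3 field_simps)
    show ?thesis
      unfolding G1 pt1[symmetric] join[OF u] bary_point_in_line_iff[OF nc v] uv mult_eq_0_iff
      by simp
  qed
  show ?thesis
    unfolding V axis Vinf harmonic_homology_def if_not_P[OF off_axis]
  proof (rule the_equality)
    show "?pt (vector [0, 3/4, -3/4]) \<in> join (Ordinary (G + t *\<^sub>R (X - Y))) (Ordinary (G - t *\<^sub>R (X - Y)))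
      \<and> Ordinary (midpoint (G + t *\<^sub>R (X - Y)) (G - t *\<^sub>R (X - Y))) \<in> ?ln (vector [0, 3/4, -3/4])"
      unfolding G2 mid using \<open>t \<noteq> 0\<close> by (subst par) auto
    fix W
    assume W: "?pt (vector [0, 3/4, -3/4]) \<in> join (Ordinary (G + t *\<^sub>R (X - Y))) (Ordinary W)
      \<and> Ordinary (midpoint (G + t *\<^sub>R (X - Y)) W) \<in> ?ln (vector [0, 3/4, -3/4])"
    obtain p where p: "(W, 1) = (bary_vector G X Y p, bary_weight p)"
      by (rule surjE[OF bij_is_surj[OF bary_bij[OF nc]]])
    obtain a b c where "p = vector [a, b, c]"
      by (rule vector3_cases)
    with p have a: "a = 1 - b - c" and abc: "W = a *\<^sub>R G + b *\<^sub>R X + c *\<^sub>R Y"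
      by (simp_all add: bary_weight_def bary_vector_def)
    have Wbc: "W = G + b *\<^sub>R (X - G) + c *\<^sub>R (Y - G)"
      unfolding abc a by (simp add: algebra_simps)
    \<comment> \<open>The midpoint condition and the direction condition are two linear equations for \<open>b\<close> and \<open>c\<close>.\<close>
    have m: "t + b = c - t"
      using W mid[of b c] Wbc by simp
    then have "b \<noteq> t \<or> c \<noteq> - t"
      using \<open>t \<noteq> 0\<close> by auto
    from par[OF this] have "b + c = 0"
      using W Wbc by simp
    with m have "b = - t" "c = t"
      by simp_all
    then show "W = G - t *\<^sub>R (X - Y)"
      by (simp add: Wbc G2)
  qed
qed

text \<open>If \<open>(1 : 1 : 1)\<close> were a combination \<open>a (x, y, z) + b (yz, zx, xy)\<close> up to a factor, comparing
coordinates would give \<open>a = b x = b y\<close> for distinct \<open>x\<close>, \<open>y\<close>, and both coefficients would vanish. Collinearity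
yields such a combination unless \<open>P = P'\<close>.\<close>

lemma isotomic_points_not_collinear_with_centroid:
  assumes nc: "\<not> collinear {A, B, C}" and nz: "x \<noteq> 0" "y \<noteq> 0" "z \<noteq> 0"
    and sums: "y + z \<noteq> 0" "z + x \<noteq> 0" "x + y \<noteq> 0"
    and ne: "x \<noteq> y" "y \<noteq> z" "z \<noteq> x"
    and X: "Ordinary X = bary_point A B C (vector [x, y, z])"
    and Y: "Ordinary Y = bary_point A B C (vector [y * z, z * x, x * y])"
  shows "\<not> collinear {centroid A B C, X, Y}"
proof
  let ?p = "vector [x, y, z] :: real^3" and ?q = "vector [y * z, z * x, x * y] :: real^3"
  let ?G = "centroid A B C"
  have wp: "bary_weight ?p \<noteq> 0" and wq: "bary_weight ?q \<noteq> 0"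
    using X Y by (metis ordinary_bary_point_iff ordinary_def rangeI)+
  have X': "X = bary_vector A B C ?p /\<^sub>R bary_weight ?p"
    and Y': "Y = bary_vector A B C ?q /\<^sub>R bary_weight ?q"
    using X Y wp wq by (simp_all add: bary_point_ordinary)
  assume "collinear {?G, X, Y}"
  then have "collinear {X, ?G, Y}"
    by (simp add: insert_commute)
  then consider "X = Y" | u where "?G = u *\<^sub>R X + (1 - u) *\<^sub>R Y"
    by (auto simp: collinear_3_expand)
  then show False
  proof cases
    case 1
    then have "bary_point A B C ?p = bary_point A B C ?q"
      using X Y by simp
    moreover have "?p \<noteq> 0" "?q \<noteq> 0"
      using nz by (simp_all add: vector3_eq_0_iff)
    ultimately have "?p \<times> ?q = 0"
      using bary_point_eq_iff[OF nc] by blast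
    then show False
      using isotomic_points_distinct[OF nz sums] ne by simp
  next
    case 2
    define a b where "a = u / bary_weight ?p" and "b = (1 - u) / bary_weight ?q"
    define r where "r = a *\<^sub>R ?p + b *\<^sub>R ?q"
    have "bary_weight r = a * bary_weight ?p + b * bary_weight ?q"
      by (simp add: r_def bary_weight_def algebra_simps)
    then have wr: "bary_weight r = 1"
      using wp wq by (simp add: a_def b_def)
    have "bary_vector A B C r = a *\<^sub>R bary_vector A B C ?p + b *\<^sub>R bary_vector A B C ?q"
      by (simp add: r_def bary_vector_def algebra_simps)
    also have "\<dots> = ?G"
      unfolding 2 X' Y' a_def b_def by (simp add: divide_inverse)
    finally have "bary_point A B C r = Ordinary ?G"
      using wr by (simp add: bary_point_ordinary)
    also have "Ordinary ?G = bary_point A B C (vector [1, 1, 1])"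
      by (simp add: bary_point_ordinary bary_weight_def bary_vector_def centroid_def)
    finally have "bary_point A B C r = bary_point A B C (vector [1, 1, 1])" .
    moreover have "r \<noteq> 0" "vector [1, 1, 1] \<noteq> (0 :: real^3)"
      using wr by (auto simp: vector3_eq_0_iff bary_weight_def)
    ultimately have "r \<times> vector [1, 1, 1] = 0"
      using bary_point_eq_iff[OF nc] by blast
    then have "(r \<times> vector [1, 1, 1])$1 = 0" "(r \<times> vector [1, 1, 1])$2 = 0"
      by simp_all
    then have "r$2 = r$3" "r$3 = r$1"
      unfolding cross_components by simp_all
    moreover have "(y - z) * (a - b * x) = r$2 - r$3" "(z - x) * (a - b * y) = r$3 - r$1"
      by (simp_all add: r_def algebra_simps)
    ultimately have "(y - z) * (a - b * x) = 0" "(z - x) * (a - b * y) = 0"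
      by linarith+
    then have "a = b * x" "a = b * y"
      using ne by simp_all
    then have "b * (x - y) = 0"
      by algebra
    then have "b = 0"
      using ne by simp
    then have "a = 0"
      using \<open>a = b * x\<close> by simp
    then show False
      using wr \<open>b = 0\<close> by (simp add: r_def bary_weight_def)
  qed
qed

theorem lemma2p5:
  fixes A B C G G1 G2 :: "real^2" and P P' :: xpoint and K :: "real^2 \<Rightarrow> real^2"
  assumes "\<not> collinear {A, B, C}"
    and "G = centroid A B C"
    and "K = complement_map A B C"
    and "\<not> on_sides A B C P"
    and "\<not> on_sides (inv K A) (inv K B) (inv K C) P"
    and "P' = isotomic_conjugate A B C P"
    and "G1 = cevian_map A B C P G"
    and "G2 = isotomic_cevian_map A B C P G"
  shows "G = midpoint G1 G2
    \<and> (P \<noteq> Ordinary G \<longrightarrow> parallel (join (Ordinary G1) (Ordinary G2)) (join P P'))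
    \<and> (ordinary P \<and> ordinary P' \<and> \<not> on_medians A B C P \<longrightarrow> eta A B C P G1 = G2)"
proof -
  note nc = assms(1)
  obtain p where "p \<noteq> 0" "P = bary_point A B C p"
    by (rule bary_point_cases[OF nc])
  moreover obtain x y z where "p = vector [x, y, z]"
    by (rule vector3_cases)
  ultimately have p: "vector [x, y, z] \<noteq> (0 :: real^3)" and P: "P = bary_point A B C (vector [x, y, z])"
    by simp_all
  have nz: "x \<noteq> 0" "y \<noteq> 0" "z \<noteq> 0"
    using assms(4) on_sides_bary_iff[OF nc p] by (auto simp: P)
  have sums: "y + z \<noteq> 0" "z + x \<noteq> 0" "x + y \<noteq> 0"
    using assms(5) on_anticomplementary_sides_bary_iff[OF nc p]
    unfolding P assms(3) inv_complement_map by auto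
  let ?p = "vector [x, y, z] :: real^3" and ?q = "vector [y * z, z * x, x * y] :: real^3"
  let ?d = "isotomic_direction x y z"
  define s where "s = x + y + z"
  define s' where "s' = x * y + y * z + z * x"
  define k where "k = 1 / (3 * ((x + y) * (y + z) * (z + x)))"
  have P': "P' = bary_point A B C ?q"
    unfolding assms(6) P by (rule isotomic_conjugate_bary[OF nc nz sums])
  have G1: "G1 = G + k *\<^sub>R bary_vector A B C ?d"
    unfolding assms(7) P assms(2) k_def
    by (simp only: centroid_cevian_map[OF nc sums] centroid_of_cevian_triangle[OF sums])
  have "G1 + G2 = 2 *\<^sub>R G"
    unfolding assms(7,8) P assms(2)
    by (simp only: centroid_cevian_map[OF nc sums] centroid_isotomic_cevian_map[OF nc sums]
        centroid_of_isotomic_cevian_triangle[OF sums])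
  then have mid: "G = midpoint G1 G2" and "G2 = 2 *\<^sub>R G - G1"
    by (simp_all add: midpoint_def algebra_simps)
  then have G2: "G2 = G - k *\<^sub>R bary_vector A B C ?d"
    by (simp add: G1 scaleR_2)
  have wp: "bary_weight ?p = s" and wq: "bary_weight ?q = s'" and wd: "bary_weight ?d = 0"
    using bary_weight_isotomic_direction by (simp_all add: bary_weight_def s_def s'_def)
  have "k \<noteq> 0"
    using sums by (simp add: k_def)

  have "parallel (join (Ordinary G1) (Ordinary G2)) (join P P')" if "P \<noteq> Ordinary G"
  proof -
    let ?g = "vector [1/3, 1/3, 1/3] :: real^3"
    have "\<not> (x = y \<and> y = z)"
    proof
      assume "x = y \<and> y = z"
      then have "P = Ordinary G"
        using nz by (simp add: P assms(2) bary_point_ordinary bary_weight_def bary_vector_def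
            centroid_def flip: scaleR_add_right)
      then show False using that by simp
    qed
    then have pq: "?p \<times> ?q \<noteq> 0" and d: "?d \<noteq> 0"
      using isotomic_points_distinct[OF nz sums] isotomic_direction_nonzero[OF sums] by blast+
    have "?g \<noteq> 0"
      by (simp add: vector3_eq_0_iff)
    \<comment> \<open>A multiple of the coordinates of \<open>G\<close> is determined by its weight, and \<open>d\<close> has weight \<open>0\<close>.\<close>
    have gd: "?g \<times> ?d \<noteq> 0"
    proof
      assume "?g \<times> ?d = 0"
      then obtain c where "?d = c *\<^sub>R ?g"
        using cross3_eq_0_iff_parallel[OF \<open>?g \<noteq> 0\<close>] by blast
      then have "bary_weight ?d = c"
        by (simp add: bary_weight_def)
      with wd \<open>?d = c *\<^sub>R ?g\<close> d show False
        by simp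
    qed
    have pts: "Ordinary G1 = bary_point A B C (?g + k *\<^sub>R ?d)"
      "Ordinary G2 = bary_point A B C (?g - k *\<^sub>R ?d)"
    proof -
      have w: "bary_weight (?g + c *\<^sub>R ?d) = 1" for c
      proof -
        have "bary_weight (?g + c *\<^sub>R ?d) = 1 + c * bary_weight ?d"
          by (simp add: bary_weight_def algebra_simps)
        then show ?thesis by (simp add: wd)
      qed
      have v: "bary_vector A B C (?g + c *\<^sub>R ?d) = G + c *\<^sub>R bary_vector A B C ?d" for c
        by (simp add: bary_vector_def assms(2) centroid_def algebra_simps)
      show "Ordinary G1 = bary_point A B C (?g + k *\<^sub>R ?d)"
        by (simp add: bary_point_ordinary w v G1)
      show "Ordinary G2 = bary_point A B C (?g - k *\<^sub>R ?d)"
        using w[of "- k"] v[of "- k"] by (simp add: bary_point_ordinary G2)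
    qed
    have cross: "(?g + k *\<^sub>R ?d) \<times> (?g - k *\<^sub>R ?d) = (- 2 * k) *\<^sub>R (?g \<times> ?d)"
    proof -
      have "(u + k *\<^sub>R v) \<times> (u - k *\<^sub>R v) = (- 2 * k) *\<^sub>R (u \<times> v)" for u v :: "real^3"
        by (simp add: vec3_eq_iff cross_components algebra_simps)
      then show ?thesis .
    qed
    then have cross_nz: "(?g + k *\<^sub>R ?d) \<times> (?g - k *\<^sub>R ?d) \<noteq> 0"
      using gd \<open>k \<noteq> 0\<close> by simp
    have Z1: "bary_point A B C ?d \<in> join (Ordinary G1) (Ordinary G2)"
      unfolding pts join_bary_points[OF nc cross_nz] cross
      using nc d by (simp add: bary_point_in_line_iff dot_cross_self)
    have "(?p \<times> ?q) \<bullet> ?d = 0"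
      by (simp add: isotomic_direction_def inner_diff_right dot_cross_self)
    then have Z2: "bary_point A B C ?d \<in> join P P'"
      unfolding P P' join_bary_points[OF nc pq] bary_point_in_line_iff[OF nc d] .
    \<comment> \<open>At least one of \<open>P\<close>, \<open>P'\<close> is ordinary: \<open>s = s' = 0\<close> forces \<open>x\<^sup>2 + y\<^sup>2 + z\<^sup>2 = 0\<close>.\<close>
    have "s \<noteq> 0 \<or> s' \<noteq> 0"
    proof (rule ccontr)
      assume "\<not> (s \<noteq> 0 \<or> s' \<noteq> 0)"
      moreover have "x\<^sup>2 + y\<^sup>2 + z\<^sup>2 = s\<^sup>2 - 2 * s'"
        by (simp add: s_def s'_def power2_eq_square algebra_simps)
      ultimately have "x\<^sup>2 + y\<^sup>2 + z\<^sup>2 = 0"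
        by simp
      then show False
        using nz(1) by (smt (verit) zero_le_power2 zero_eq_power2)
    qed
    then have "join P P' \<in> ordinary_lines"
      unfolding P P' using join_bary_in_ordinary_lines[OF nc pq] wp wq by simp
    moreover have "bary_weight (?g + k *\<^sub>R ?d) \<noteq> 0"
      unfolding ordinary_bary_point_iff[of A B C, symmetric] pts(1)[symmetric]
      by (simp add: ordinary_def)
    then have "join (Ordinary G1) (Ordinary G2) \<in> ordinary_lines"
      using join_bary_in_ordinary_lines[OF nc cross_nz, folded pts] by blast
    moreover have "\<not> ordinary (bary_point A B C ?d)"
      by (simp add: ordinary_bary_point_iff wd)
    ultimately show ?thesis
      using parallel_iff_infinite_point Z1 Z2 by blast
  qed

  moreover have "eta A B C P G1 = G2"
    if ord: "ordinary P" "ordinary P'" and med: "\<not> on_medians A B C P"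
  proof -
    obtain X Y where X: "P = Ordinary X" and Y: "P' = Ordinary Y"
      using ord by (auto simp: ordinary_def)
    have s: "s \<noteq> 0" "s' \<noteq> 0"
      using ord unfolding P P' ordinary_bary_point_iff wp wq by blast+
    have ne: "x \<noteq> y" "y \<noteq> z" "z \<noteq> x"
      using med on_medians_bary_iff[OF nc p] by (auto simp: P)
    have ncG: "\<not> collinear {G, X, Y}"
      unfolding assms(2)
      using isotomic_points_not_collinear_with_centroid[OF nc nz sums ne] X Y P P' by metis
    have "X = bary_vector A B C ?p /\<^sub>R s" "Y = bary_vector A B C ?q /\<^sub>R s'"
      using X Y P P' s by (simp_all add: bary_point_ordinary wp wq)
    then have XY: "bary_vector A B C ?p = s *\<^sub>R X" "bary_vector A B C ?q = s' *\<^sub>R Y"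
      using s by simp_all
    have "bary_vector A B C ?d = s' *\<^sub>R bary_vector A B C ?p - s *\<^sub>R bary_vector A B C ?q"
      by (simp add: isotomic_direction_def bary_vector_def s_def s'_def algebra_simps)
    also have "\<dots> = (s * s') *\<^sub>R (X - Y)"
      unfolding XY by (simp add: algebra_simps)
    finally have d: "k *\<^sub>R bary_vector A B C ?d = (k * (s * s')) *\<^sub>R (X - Y)"
      by simp
    have t: "k * (s * s') \<noteq> 0"
      using s \<open>k \<noteq> 0\<close> by simp
    show ?thesis
      unfolding eta_def Let_def assms(6)[symmetric] unfolding X Y complement_map_def ext_map.simps
        assms(2)[symmetric] G1 G2 d
      by (rule harmonic_homology_on_parallel[OF ncG t])
  qed
  ultimately show ?thesis
    using mid by blast
qed

end
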